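(* Assume one of the following: (H) $A\in\mathbb{C}^{n\times n}$ is $H$-selfadjoint with respect to some nonsingular Hermitian $H\in\mathbb{C}^{n\times n}$, and $u\in\mathbb{C}^n\setminus\{0\}$; put $v^*=u^*H$; (J) $A\in\mathbb{R}^{n\times n}$ is $J$-Hamiltonian with respect to some nonsingular skew-symmetric $J\in\mathbb{R}^{n\times n}$, and $u\in\mathbb{R}^n\setminus\{0\}$; put $v^*=u^\top J$. Let $Q(\lambda)=v^*(\lambda I_n-A)^{-1}u$. If for some $\tau_0>0$ an analytic definition of the eigenvalues of $A+\tau uv^*$ at $\tau_0$ is not possible due to $$Q(x)=1/\tau_0,\quad Q'(x)=0,\quad Q''(x)\neq0$$ for some $x\in\mathbb{R}$ which is not an eigenvalue of $A$, then for all (H) $\tilde A\in\mathbb{C}^{n\times n}$ being $H$-selfadjoint, $\tilde u\in\mathbb{C}^n$, (J) $\tilde A\in\mathbb{R}^{n\times n}$ being $J$-Hamiltonian, $\tilde u\in\mathbb{R}^n$ (respectively), with $\|\tilde u-u\|$ and $\|\tilde A-A\|$ sufficiently small, the analytic definition of the eigenvalues of $\tilde A+\tau\tilde u\tilde u^*H$ (respectively $\tilde A+\tau\tilde u\tilde u^\top J$) is not possible due to the existence of $\tilde x\in\mathbb{R}$ and $\tilde\tau_0>0$, depending continuously on $\tilde A,\tilde u$, with $$\widetilde Q(\tilde x)=1/\tilde\tau_0,\quad\widetilde Q'(\tilde x)=0,\quad\widetilde Q''(\tilde x)\neq0,$$ where $\widetilde Q(\lambda)=\tilde u^*H(\lambda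 I_n-\tilde A)^{-1}\tilde u$ in case (H) and $\widetilde Q(\lambda)=\tilde u^\top J(\lambda I_n-\tilde A)^{-1}\tilde u$ in case (J).
   Context: $X^*=\bar X^\top$. A matrix $A\in\mathbb{C}^{n\times n}$ is $H$-selfadjoint if $HA=A^*H$, where $H\in\mathbb{C}^{n\times n}$ is Hermitian and nonsingular. A matrix $A\in\mathbb{R}^{n\times n}$ is $J$-Hamiltonian if $JA=-A^\top J$, where $J\in\mathbb{R}^{n\times n}$ is nonsingular with $J=-J^\top$. The perturbations considered are $A+\tau uu^*H$ in case (H) and $A+\tau uu^\top J$ in case (J). Background on the phrase "analytic definition is not possible": if $\lambda_0$ is not an eigenvalue of $A$, then $\lambda_0$ is an eigenvalue of $A+\tau_0uv^*$ of algebraic multiplicity $\kappa$ if and only if $Q(\lambda_0)=1/\tau_0$, $Q'(\lambda_0)=\dots=Q^{(\kappa-1)}(\lambda_0)=0$, $Q^{(\kappa)}(\lambda_0)\neq0$. If $\kappa=1$ the eigenvalue near $\lambda_0$ is an analytic function of $\tau$ near $\tau_0$. If $\kappa>1$ the eigenvalues near $\lambda_0$ cannot be given by analytic functions of $\tau$ in a neighbourhood of $\tau_0$; they expand in Puiseux series, behaving locally as the solutions of $(\lambda-\lambda_0)^\kappa=\tau-\tau_0$. The displayed conditions are the case $\kappa=2$. *)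

theory Defs
  imports "HOL-Analysis.Analysis"
begin

definition map_vector :: "('a \<Rightarrow> 'b) \<Rightarrow> 'a ^ 'n \<Rightarrow> 'b ^ 'n" where
  "map_vector f v = (\<chi> i. f (v $ i))"

definition conj_transpose :: "complex ^ 'n ^ 'm \<Rightarrow> complex ^ 'm ^ 'n" where
  "conj_transpose A = transpose (map_matrix cnj A)"

definition H_selfadjoint :: "complex ^ 'n ^ 'n \<Rightarrow> complex ^ 'n ^ 'n \<Rightarrow> bool" where
  "H_selfadjoint H A \<longleftrightarrow> H ** A = conj_transpose A ** H"

definition J_Hamiltonian :: "real ^ 'n ^ 'n \<Rightarrow> real ^ 'n ^ 'n \<Rightarrow> bool" where
  "J_Hamiltonian J A \<longleftrightarrow> J ** A = - (transpose A ** J)"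

definition outer_product :: "'a::times ^ 'm \<Rightarrow> 'a ^ 'n \<Rightarrow> 'a ^ 'n ^ 'm" where
  "outer_product u w = (\<chi> i j. u $ i * w $ j)"

text \<open>The row vectors \<open>v* = u* H\<close> and \<open>v* = u\<^sup>T J\<close>, stored as vectors. No
  further conjugation is to be applied to them.\<close>

definition row_H :: "complex ^ 'n ^ 'n \<Rightarrow> complex ^ 'n \<Rightarrow> complex ^ 'n" where
  "row_H H u = map_vector cnj u v* H"

definition row_J :: "real ^ 'n ^ 'n \<Rightarrow> real ^ 'n \<Rightarrow> real ^ 'n" where
  "row_J J u = u v* J"

definition is_eigenvalue :: "complex ^ 'n ^ 'n \<Rightarrow> complex \<Rightarrow> bool" where
  "is_eigenvalue A z \<longleftrightarrow> (\<exists>v. v \<noteq> 0 \<and> A *v v = z *s v)"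

text \<open>\<open>w (z I - A)\<^sup>-\<^sup>1 u\<close> for a row vector \<open>w\<close>. This is meaningful only
  when \<open>z\<close> is not an eigenvalue of \<open>A\<close>.\<close>

definition resolvent_fun ::
    "complex ^ 'n ^ 'n \<Rightarrow> complex ^ 'n \<Rightarrow> complex ^ 'n \<Rightarrow> complex \<Rightarrow> complex" where
  "resolvent_fun A u w z = scalar_product w (matrix_inv (mat z - A) *v u)"

definition Q_H :: "complex ^ 'n ^ 'n \<Rightarrow> complex ^ 'n ^ 'n \<Rightarrow> complex ^ 'n \<Rightarrow> complex \<Rightarrow> complex" where
  "Q_H H A u = resolvent_fun A u (row_H H u)"

text \<open>In the real case matrices and vectors are embedded into the complex ones,
  so that \<open>Q\<close> is a function of a complex variable and eigenvalues are sought
  in the complex plane.\<close>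

definition Q_J :: "real ^ 'n ^ 'n \<Rightarrow> real ^ 'n ^ 'n \<Rightarrow> real ^ 'n \<Rightarrow> complex \<Rightarrow> complex" where
  "Q_J J A u = resolvent_fun (map_matrix complex_of_real A)
     (map_vector complex_of_real u) (map_vector complex_of_real (row_J J u))"

definition pert_H :: "complex ^ 'n ^ 'n \<Rightarrow> complex ^ 'n ^ 'n \<Rightarrow> complex ^ 'n \<Rightarrow> real
    \<Rightarrow> complex ^ 'n ^ 'n" where
  "pert_H H A u \<tau> = A + \<tau> *\<^sub>R outer_product u (row_H H u)"

definition pert_J :: "real ^ 'n ^ 'n \<Rightarrow> real ^ 'n ^ 'n \<Rightarrow> real ^ 'n \<Rightarrow> real
    \<Rightarrow> complex ^ 'n ^ 'n" where
  "pert_J J A u \<tau> = map_matrix complex_of_real (A + \<tau> *\<^sub>R outer_product u (row_J J u))"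

definition double_crossing :: "(complex \<Rightarrow> complex) \<Rightarrow> real \<Rightarrow> real \<Rightarrow> bool" where
  "double_crossing Q x \<tau> \<longleftrightarrow>
     Q (of_real x) = 1 / of_real \<tau> \<and>
     deriv Q (of_real x) = 0 \<and>
     deriv (deriv Q) (of_real x) \<noteq> 0"

text \<open>The eigenvalues of \<open>M \<tau>\<close> near \<open>z\<^sub>0\<close> are given, for real \<open>\<tau>\<close> near
  \<open>\<tau>\<^sub>0\<close>, by finitely many functions analytic at \<open>\<tau>\<^sub>0\<close>. Real-analytic
  complex-valued functions of \<open>\<tau>\<close> are represented by their holomorphic extensions.
  Multiplicities are not recorded; this makes the notion weaker, hence its negation
  stronger.\<close>

definition analytic_eigenvalues_near ::
    "(real \<Rightarrow> complex ^ 'n ^ 'n) \<Rightarrow> real \<Rightarrow> complex \<Rightarrow> bool" where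
  "analytic_eigenvalues_near M \<tau>\<^sub>0 z\<^sub>0 \<longleftrightarrow>
     (\<exists>F r. finite F \<and> r > 0 \<and>
        (\<forall>f\<in>F. f analytic_on {complex_of_real \<tau>\<^sub>0}) \<and>
        (\<forall>\<^sub>F \<tau> in nhds \<tau>\<^sub>0.
           {z \<in> ball z\<^sub>0 r. is_eigenvalue (M \<tau>) z} = (\<lambda>f. f (complex_of_real \<tau>)) ` F))"

definition nbhd_H :: "complex ^ 'n ^ 'n \<Rightarrow> complex ^ 'n ^ 'n \<Rightarrow> complex ^ 'n \<Rightarrow> real
    \<Rightarrow> ((complex ^ 'n ^ 'n) \<times> (complex ^ 'n)) set" where
  "nbhd_H H A u \<delta> = {(B, w). H_selfadjoint H B \<and> norm (B - A) < \<delta> \<and> norm (w - u) < \<delta>}"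

definition nbhd_J :: "real ^ 'n ^ 'n \<Rightarrow> real ^ 'n ^ 'n \<Rightarrow> real ^ 'n \<Rightarrow> real
    \<Rightarrow> ((real ^ 'n ^ 'n) \<times> (real ^ 'n)) set" where
  "nbhd_J J A u \<delta> = {(B, w). J_Hamiltonian J B \<and> norm (B - A) < \<delta> \<and> norm (w - u) < \<delta>}"

end

theory Submission
  imports Defs
begin

text \<open>On the real axis \<open>Q\<close> is real-valued, in both cases, hence so are \<open>Q'\<close> and \<open>Q''\<close>. By the
  resolvent identity \<open>Q' = - w R\<^sup>2 u\<close> and \<open>Q'' = 2 w R\<^sup>3 u\<close> with \<open>R = (z I - A)\<^sup>-\<^sup>1\<close>, and by Cramer's
  rule these depend jointly continuously on \<open>z\<close> and the data. Near \<open>x\<close> the real function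
  \<open>Q'\<close> is therefore strictly monotone for all nearby data, so it has there exactly one zero, which
  depends continuously on the data; \<open>T\<close> is \<open>1 / Q\<close> at this zero.\<close>

section \<open>Matrix inverses and determinants under limits\<close>

lemma matrix_inv_both:
  fixes M :: "'a::field ^ 'n ^ 'n"
  assumes "det M \<noteq> 0"
  shows "M ** matrix_inv M = mat 1" "matrix_inv M ** M = mat 1"
proof -
  have "\<exists>N. M ** N = mat 1 \<and> N ** M = mat 1"
    using assms invertible_det_nz[of M] by (simp add: invertible_def)
  then show "M ** matrix_inv M = mat 1" "matrix_inv M ** M = mat 1"
    unfolding matrix_inv_def by (metis (mono_tags, lifting) someI_ex)+
qed

lemma matrix_inv_mult_vec_eq_iff:
  fixes M :: "'a::field ^ 'n ^ 'n"
  assumes "det M \<noteq> 0"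
  shows "matrix_inv M *v b = y \<longleftrightarrow> M *v y = b"
  using matrix_inv_both[OF assms]
  by (metis matrix_vector_mul_assoc matrix_vector_mul_lid)

lemma tendsto_det:
  fixes M :: "'b \<Rightarrow> 'a::real_normed_field ^ 'n ^ 'n"
  assumes "(M \<longlongrightarrow> M0) F"
  shows "((\<lambda>x. det (M x)) \<longlongrightarrow> det M0) F"
  unfolding det_def by (intro tendsto_intros assms)

text \<open>Where the determinant is nonzero, which holds eventually, Cramer's rule writes each
  component of the solution as a quotient of two determinants, and these are polynomials in the
  entries.\<close>

lemma tendsto_matrix_inv_mult_vec:
  fixes M :: "'b \<Rightarrow> 'a::real_normed_field ^ 'n ^ 'n"
  assumes M: "(M \<longlongrightarrow> M0) F" and b: "(b \<longlongrightarrow> b0) F" and M0: "det M0 \<noteq> 0"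
  shows "((\<lambda>x. matrix_inv (M x) *v b x) \<longlongrightarrow> matrix_inv M0 *v b0) F"
proof -
  \<comment> \<open>\<open>C N c k\<close> is \<open>N\<close> with its column \<open>k\<close>
    replaced by \<open>c\<close>, the numerator matrix in Cramer's rule.\<close>
  define C :: "'a ^ 'n ^ 'n \<Rightarrow> 'a ^ 'n \<Rightarrow> 'n \<Rightarrow> 'a ^ 'n ^ 'n"
    where "C = (\<lambda>N c k. \<chi> i j. if j = k then c $ i else N $ i $ j)"
  have inv: "matrix_inv N *v c = (\<chi> k. det (C N c k) / det N)" if "det N \<noteq> 0" for N c
    unfolding C_def using that by (simp add: matrix_inv_mult_vec_eq_iff cramer)
  have "((\<lambda>x. C (M x) (b x) k) \<longlongrightarrow> C M0 b0 k) F" for k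
    unfolding C_def by (intro tendsto_vec_lambda) (auto intro!: tendsto_intros M b)
  then have "((\<lambda>x. \<chi> k. det (C (M x) (b x) k) / det (M x)) \<longlongrightarrow> (\<chi> k. det (C M0 b0 k) / det M0)) F"
    by (intro tendsto_intros tendsto_det M M0)
  moreover have "\<forall>\<^sub>F x in F. (\<chi> k. det (C (M x) (b x) k) / det (M x)) = matrix_inv (M x) *v b x"
    using tendsto_imp_eventually_ne[OF tendsto_det[OF M] M0]
    by eventually_elim (simp add: inv)
  ultimately show ?thesis
    using M0 by (auto simp: inv dest: Lim_transform_eventually)
qed

lemma tendsto_scalar_product:
  fixes v w :: "'b \<Rightarrow> 'a::real_normed_field ^ 'n"
  assumes "(v \<longlongrightarrow> v0) F" "(w \<longlongrightarrow> w0) F"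
  shows "((\<lambda>x. scalar_product (v x) (w x)) \<longlongrightarrow> scalar_product v0 w0) F"
  unfolding scalar_product_def by (intro tendsto_intros assms)

lemma scalar_product_algebra:
  fixes v w x :: "'a::comm_ring_1 ^ 'n"
  shows "scalar_product v (w - x) = scalar_product v w - scalar_product v x"
    and "scalar_product v (w + x) = scalar_product v w + scalar_product v x"
    and "scalar_product v (c *s w) = c * scalar_product v w"
  by (simp_all add: scalar_product_def distrib_left sum.distrib right_diff_distrib sum_subtractf sum_distrib_left mult_ac)

section \<open>Eigenvalues and the resolvent\<close>

lemma mat_mult_vec:
  fixes v :: "'a::comm_semiring_1 ^ 'n"
  shows "mat c *v v = c *s v"
  by (simp add: vec_eq_iff mat_def matrix_vector_mult_def if_distrib if_distribR
      cong del: if_weak_cong)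

text \<open>The determinant is continuous in the matrix and in \<open>z\<close>, so this form shows
  that not being an eigenvalue is an open condition.\<close>

lemma is_eigenvalue_iff_det: "is_eigenvalue B z \<longleftrightarrow> det (mat z - B) = 0"
proof -
  have "det (mat z - B) \<noteq> 0 \<longleftrightarrow> (\<forall>v. (mat z - B) *v v = 0 \<longrightarrow> v = 0)"
    by (metis invertible_det_nz invertible_left_inverse matrix_left_invertible_ker)
  moreover have "(mat z - B) *v v = 0 \<longleftrightarrow> B *v v = z *s v" for v
    by (auto simp: matrix_vector_mult_diff_rdistrib mat_mult_vec)
  ultimately show ?thesis
    unfolding is_eigenvalue_def by blast
qed

lemma tendsto_mat:
  assumes "(f \<longlongrightarrow> c) F"
  shows "((\<lambda>x. mat (f x) :: 'a::real_normed_field ^ 'n ^ 'n) \<longlongrightarrow> mat c) F"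
  unfolding mat_def by (intro tendsto_vec_lambda) (auto intro: assms)

text \<open>The resolvent is applied to a vector, so that its powers become iterates and
  computations reduce to the linear system in \<open>resolvent_eq_iff\<close>.\<close>

definition resolvent :: "complex ^ 'n ^ 'n \<Rightarrow> complex \<Rightarrow> complex ^ 'n \<Rightarrow> complex ^ 'n" where
  "resolvent B z u = matrix_inv (mat z - B) *v u"

lemma resolvent_fun_eq: "resolvent_fun B u w z = scalar_product w (resolvent B z u)"
  by (simp add: resolvent_fun_def resolvent_def)

lemma resolvent_eq_iff:
  assumes "\<not> is_eigenvalue B z"
  shows "resolvent B z u = y \<longleftrightarrow> z *s y - B *v y = u"
  using assms matrix_inv_mult_vec_eq_iff[of "mat z - B" u y]
  by (simp add: resolvent_def is_eigenvalue_iff_det matrix_vector_mult_diff_rdistrib mat_mult_vec)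

lemma resolvent_diff: "resolvent B z (u - v) = resolvent B z u - resolvent B z v"
  and resolvent_scale: "resolvent B z (c *s u) = c *s resolvent B z u"
  by (simp_all add: resolvent_def matrix_vector_mult_diff_distrib vector_scalar_commute)

text \<open>For \<open>v = R(y) u\<close> one has \<open>(z - B) v = u - (y - z) v\<close>; applying
  \<open>R(z)\<close> to both sides and rearranging gives the claim.\<close>

lemma resolvent_identity:
  assumes "\<not> is_eigenvalue B z" "\<not> is_eigenvalue B y"
  shows "resolvent B z u - resolvent B y u = (y - z) *s resolvent B z (resolvent B y u)"
proof -
  define v where "v = resolvent B y u"
  have u: "y *s v - B *v v = u"
    using resolvent_eq_iff[OF assms(2)] v_def by blast
  have "resolvent B z (z *s v - B *v v) = v"
    using resolvent_eq_iff[OF assms(1)] by blast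
  moreover have "z *s v - B *v v = u - (y - z) *s v"
    using u by (auto simp: vec_eq_iff algebra_simps)
  ultimately have "resolvent B z u - (y - z) *s resolvent B z v = v"
    by (simp add: resolvent_diff resolvent_scale)
  then show ?thesis
    by (simp add: v_def algebra_simps)
qed

lemma tendsto_resolvent:
  assumes "(B \<longlongrightarrow> B0) F" "(z \<longlongrightarrow> z0) F" "(u \<longlongrightarrow> u0) F" "\<not> is_eigenvalue B0 z0"
  shows "((\<lambda>p. resolvent (B p) (z p) (u p)) \<longlongrightarrow> resolvent B0 z0 u0) F"
  unfolding resolvent_def using assms
  by (intro tendsto_matrix_inv_mult_vec tendsto_diff tendsto_mat) (auto simp: is_eigenvalue_iff_det)

lemma eventually_not_is_eigenvalue:
  assumes "(B \<longlongrightarrow> B0) F" "(z \<longlongrightarrow> z0) F" "\<not> is_eigenvalue B0 z0"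
  shows "\<forall>\<^sub>F p in F. \<not> is_eigenvalue (B p) (z p)"
  using tendsto_imp_eventually_ne[OF tendsto_det[OF tendsto_diff[OF tendsto_mat[OF assms(2)] assms(1)]]] assms(3)
  by (simp add: is_eigenvalue_iff_det)

section \<open>Derivatives of the resolvent function\<close>

definition resolvent_fun' ::
    "complex ^ 'n ^ 'n \<Rightarrow> complex ^ 'n \<Rightarrow> complex ^ 'n \<Rightarrow> complex \<Rightarrow> complex" where
  "resolvent_fun' B u w z = - scalar_product w (resolvent B z (resolvent B z u))"

text \<open>Like \<open>resolvent_fun'\<close>, this is an explicit formula instead of a
  \<open>deriv\<close>, so that joint limits in \<open>z\<close>, the matrix and the vectors can be
  read off.\<close>

definition resolvent_fun'' ::
    "complex ^ 'n ^ 'n \<Rightarrow> complex ^ 'n \<Rightarrow> complex ^ 'n \<Rightarrow> complex \<Rightarrow> complex" where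
  "resolvent_fun'' B u w z = 2 * scalar_product w (resolvent B z (resolvent B z (resolvent B z u)))"

text \<open>By the resolvent identity the difference quotient is exactly
  \<open>- w R(y) R(z) u\<close>, and \<open>R(y)\<close> is continuous in \<open>y\<close>.\<close>

lemma has_field_derivative_resolvent_fun:
  assumes "\<not> is_eigenvalue B z"
  shows "(resolvent_fun B u w has_field_derivative resolvent_fun' B u w z) (at z)"
proof -
  have ev: "\<forall>\<^sub>F y in at z. \<not> is_eigenvalue B y"
    by (intro eventually_not_is_eigenvalue[OF _ _ assms] tendsto_intros)
  have "((\<lambda>y. - scalar_product w (resolvent B y (resolvent B z u))) \<longlongrightarrow> resolvent_fun' B u w z) (at z)"
    unfolding resolvent_fun'_def
    by (intro tendsto_intros tendsto_scalar_product tendsto_resolvent assms)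
  moreover have "\<forall>\<^sub>F y in at z. - scalar_product w (resolvent B y (resolvent B z u))
     = (resolvent_fun B u w y - resolvent_fun B u w z) / (y - z)"
    using ev eventually_neq_at_within[of z z UNIV]
  proof eventually_elim
    case (elim y)
    then show ?case
      using resolvent_identity[OF elim(1) assms, of u]
      by (simp add: resolvent_fun_eq flip: scalar_product_algebra(1))
        (simp add: scalar_product_algebra field_simps)
  qed
  ultimately show ?thesis
    unfolding has_field_derivative_iff by (rule Lim_transform_eventually)
qed

text \<open>The difference quotient is \<open>w R(y)^2 R(z) u + w R(y) R(z)^2 u\<close>. Both
  summands tend to \<open>w R(z)^3 u\<close>, whence the factor 2.\<close>

lemma has_field_derivative_resolvent_fun':
  assumes "\<not> is_eigenvalue B z"
  shows "(resolvent_fun' B u w has_field_derivative resolvent_fun'' B u w z) (at z)"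
proof -
  let ?R = "resolvent B"
  have ev: "\<forall>\<^sub>F y in at z. \<not> is_eigenvalue B y"
    by (intro eventually_not_is_eigenvalue[OF _ _ assms] tendsto_intros)
  have "((\<lambda>y. scalar_product w (?R y (?R y (?R z u))) + scalar_product w (?R y (?R z (?R z u))))
      \<longlongrightarrow> scalar_product w (?R z (?R z (?R z u))) + scalar_product w (?R z (?R z (?R z u)))) (at z)"
    by (intro tendsto_intros tendsto_scalar_product tendsto_resolvent assms)
  then have "((\<lambda>y. scalar_product w (?R y (?R y (?R z u))) + scalar_product w (?R y (?R z (?R z u))))
      \<longlongrightarrow> resolvent_fun'' B u w z) (at z)"
    by (simp add: resolvent_fun''_def)
  moreover have "\<forall>\<^sub>F y in at z. scalar_product w (?R y (?R y (?R z u))) + scalar_product w (?R y (?R z (?R z u)))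
     = (resolvent_fun' B u w y - resolvent_fun' B u w z) / (y - z)"
    using ev eventually_neq_at_within[of z z UNIV]
  proof eventually_elim
    case (elim y)
    \<comment> \<open>Telescoping through the mixed term \<open>R(y) R(z) u\<close> leaves two
      differences of first powers, to which the resolvent identity applies.\<close>
    have "?R y (?R y u) - ?R z (?R z u) = ?R y (?R y u - ?R z u) + (?R y (?R z u) - ?R z (?R z u))"
      by (simp add: resolvent_diff)
    also have "\<dots> = (z - y) *s (?R y (?R y (?R z u)) + ?R y (?R z (?R z u)))"
      using resolvent_identity[OF elim(1) assms, of u] resolvent_identity[OF elim(1) assms, of "?R z u"]
      by (simp only: resolvent_scale vector_add_ldistrib)
    finally have "scalar_product w (?R y (?R y u)) - scalar_product w (?R z (?R z u))
       = (z - y) * (scalar_product w (?R y (?R y (?R z u))) + scalar_product w (?R y (?R z (?R z u))))"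
      by (metis scalar_product_algebra)
    then show ?case
      using elim by (simp add: resolvent_fun'_def field_simps)
  qed
  ultimately show ?thesis
    unfolding has_field_derivative_iff by (rule Lim_transform_eventually)
qed

lemma deriv_resolvent_fun:
  "\<not> is_eigenvalue B z \<Longrightarrow> deriv (resolvent_fun B u w) z = resolvent_fun' B u w z"
  by (rule DERIV_imp_deriv[OF has_field_derivative_resolvent_fun])

text \<open>Differentiating \<open>deriv\<close> again requires its formula on a whole neighbourhood
  of \<open>z\<close>, which the openness of the set of non-eigenvalues supplies.\<close>

lemma deriv_deriv_resolvent_fun:
  assumes "\<not> is_eigenvalue B z"
  shows "deriv (deriv (resolvent_fun B u w)) z = resolvent_fun'' B u w z"
proof -
  have "\<forall>\<^sub>F y in nhds z. deriv (resolvent_fun B u w) y = resolvent_fun' B u w y"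
    using eventually_not_is_eigenvalue[of "\<lambda>_. B" B "nhds z" "\<lambda>y. y" z] assms
    by (auto elim!: eventually_mono simp: filterlim_ident deriv_resolvent_fun)
  then have "deriv (deriv (resolvent_fun B u w)) z = deriv (resolvent_fun' B u w) z"
    by (intro deriv_cong_ev refl)
  then show ?thesis
    using has_field_derivative_resolvent_fun'[OF assms] DERIV_imp_deriv by metis
qed

text \<open>Along the real axis \<open>Im f\<close> has derivative \<open>Im D\<close>, yet it is
  locally zero. Used twice, this passes realness from \<open>Q\<close> to \<open>Q'\<close> and from
  \<open>Q'\<close> to \<open>Q''\<close>.\<close>

lemma Im_has_field_derivative_eq_0:
  assumes f: "(f has_field_derivative D) (at (complex_of_real t))"
    and real: "\<forall>\<^sub>F s in nhds t. Im (f (complex_of_real s)) = 0"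
  shows "Im D = 0"
proof -
  have "((\<lambda>s. f (complex_of_real s)) has_vector_derivative D) (at t)"
    using f by (rule has_vector_derivative_real_field)
  then have "((\<lambda>s. Im (f (complex_of_real s))) has_vector_derivative Im D) (at t)"
    by (rule bounded_linear.has_vector_derivative[OF bounded_linear_Im])
  moreover have "((\<lambda>s. Im (f (complex_of_real s))) has_vector_derivative 0) (at t)"
    using has_vector_derivative_const[of 0 "at t"] real eventually_nhds_x_imp_x[OF real]
    by (subst has_vector_derivative_cong_ev[where g = "\<lambda>_. 0"]) (auto elim: eventually_mono)
  ultimately show ?thesis
    by (rule vector_derivative_unique_at)
qed

lemma tendsto_resolvent_funs:
  assumes "(B \<longlongrightarrow> B0) F" "(u \<longlongrightarrow> u0) F" "(w \<longlongrightarrow> w0) F" "(z \<longlongrightarrow> z0) F"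
    and "\<not> is_eigenvalue B0 z0"
  shows "((\<lambda>p. resolvent_fun (B p) (u p) (w p) (z p)) \<longlongrightarrow> resolvent_fun B0 u0 w0 z0) F"
    and "((\<lambda>p. resolvent_fun' (B p) (u p) (w p) (z p)) \<longlongrightarrow> resolvent_fun' B0 u0 w0 z0) F"
    and "((\<lambda>p. resolvent_fun'' (B p) (u p) (w p) (z p)) \<longlongrightarrow> resolvent_fun'' B0 u0 w0 z0) F"
  unfolding resolvent_fun_eq resolvent_fun'_def resolvent_fun''_def
  by (intro tendsto_intros tendsto_scalar_product tendsto_resolvent assms)+

section \<open>A monotone implicit function theorem\<close>

text \<open>The signs of \<open>g p\<close> at the two endpoints persist for \<open>p\<close> near
  \<open>p0\<close>, so the intermediate value theorem gives a zero; monotonicity makes it unique,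
  and bracketing it between points where the sign is stable gives continuity. The parameters range
  over an arbitrary subset of a metric space, such as a set of structured matrices.\<close>

lemma monotone_implicit_function:
  fixes g :: "'p::metric_space \<Rightarrow> real \<Rightarrow> real"
  assumes "p0 \<in> S" "\<eta> > 0"
    and cont_p: "\<And>t. t \<in> {x-\<eta>..x+\<eta>} \<Longrightarrow> continuous_on S (\<lambda>p. g p t)"
    and cont_t: "\<And>p. p \<in> S \<Longrightarrow> continuous_on {x-\<eta>..x+\<eta>} (g p)"
    and mono: "\<And>p. p \<in> S \<Longrightarrow> strict_mono_on {x-\<eta>..x+\<eta>} (g p)"
    and zero: "g p0 x = 0"
  obtains \<epsilon> X where "\<epsilon> > 0" "continuous_on (S \<inter> ball p0 \<epsilon>) X" "X p0 = x"
    "\<And>p. p \<in> S \<inter> ball p0 \<epsilon> \<Longrightarrow> X p \<in> {x-\<eta><..<x+\<eta>} \<and> g p (X p) = 0"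
proof -
  let ?I = "{x-\<eta>..x+\<eta>}"
  have less_iff: "g p s < g p t \<longleftrightarrow> s < t" if "p \<in> S" "s \<in> ?I" "t \<in> ?I" for p s t
    using strict_mono_on_less[OF mono] that by blast
  have tends: "((\<lambda>p. g p t) \<longlongrightarrow> g q t) (at q within S)" if "q \<in> S" "t \<in> ?I" for q t
    using cont_p that by (auto simp: continuous_on_def)
  have "g p0 (x-\<eta>) < 0" "0 < g p0 (x+\<eta>)"
    using less_iff[OF \<open>p0 \<in> S\<close>, of "x-\<eta>" x] less_iff[OF \<open>p0 \<in> S\<close>, of x "x+\<eta>"] \<open>\<eta> > 0\<close> zero
    by auto
  moreover from this have "\<forall>\<^sub>F p in at p0 within S. g p (x-\<eta>) < 0 \<and> 0 < g p (x+\<eta>)"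
    using \<open>p0 \<in> S\<close> \<open>\<eta> > 0\<close> by (intro eventually_conj order_tendstoD[OF tends]) auto
  ultimately obtain \<epsilon> where "\<epsilon> > 0"
    and \<epsilon>: "\<And>p. p \<in> S \<inter> ball p0 \<epsilon> \<Longrightarrow> g p (x-\<eta>) < 0 \<and> 0 < g p (x+\<eta>)"
    unfolding eventually_at by (metis Int_iff dist_commute mem_ball)
  define V where "V = S \<inter> ball p0 \<epsilon>"
  have "\<exists>t\<in>{x-\<eta><..<x+\<eta>}. g p t = 0" if "p \<in> V" for p
  proof -
    have p: "p \<in> S" "g p (x-\<eta>) < 0" "0 < g p (x+\<eta>)"
      using that \<epsilon> by (auto simp: V_def)
    obtain t where "t \<in> ?I" "g p t = 0"
      using IVT'[of "g p" "x-\<eta>" 0 "x+\<eta>"] cont_t[OF p(1)] p \<open>\<eta> > 0\<close> by auto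
    with p show ?thesis
      by (intro bexI[of _ t]) (auto simp: less_le)
  qed
  then obtain X where X: "\<And>p. p \<in> V \<Longrightarrow> X p \<in> {x-\<eta><..<x+\<eta>} \<and> g p (X p) = 0"
    by metis
  have "p0 \<in> V"
    using \<open>p0 \<in> S\<close> \<open>\<epsilon> > 0\<close> by (simp add: V_def)
  \<comment> \<open>\<open>X\<close> comes from the axiom of choice; strict monotonicity leaves
    \<open>x\<close> as the only zero it could have picked at \<open>p0\<close>.\<close>
  then have "X p0 = x"
    using X[of p0] less_iff[OF \<open>p0 \<in> S\<close>, of "X p0" x] less_iff[OF \<open>p0 \<in> S\<close>, of x "X p0"] zero \<open>\<eta> > 0\<close>
    by auto
  moreover have "continuous_on V X"
    unfolding continuous_on_def
  proof (intro ballI order_tendstoI)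
    fix q a assume q: "q \<in> V" and "a < X q"
    \<comment> \<open>The maximum keeps \<open>t\<close> inside the interval even when
      \<open>a\<close> lies to its left. Since \<open>g q t < 0\<close> persists for
      \<open>p\<close> near \<open>q\<close>, the zero \<open>X p\<close> stays to the right of
      \<open>t\<close>, hence of \<open>a\<close>.\<close>
    define t where "t = (max a (x-\<eta>) + X q) / 2"
    have t: "t \<in> ?I" "a < t" "t < X q"
      using X[OF q] \<open>a < X q\<close> by (auto simp: t_def)
    have "g q t < 0"
      using less_iff[of q t "X q"] t X[OF q] q by (auto simp: V_def)
    then have "\<forall>\<^sub>F p in at q within V. g p t < 0"
      using order_tendstoD(2)[OF tendsto_within_subset[OF tends]] q t by (auto simp: V_def)
    moreover have "\<forall>\<^sub>F p in at q within V. p \<in> V"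
      by (auto simp: eventually_at_filter)
    ultimately show "\<forall>\<^sub>F p in at q within V. a < X p"
    proof eventually_elim
      case (elim p)
      then show ?case
        using less_iff[of p t "X p"] X[of p] t by (auto simp: V_def)
    qed
  next
    fix q a assume q: "q \<in> V" and "X q < a"
    define t where "t = (min a (x+\<eta>) + X q) / 2"
    have t: "t \<in> ?I" "t < a" "X q < t"
      using X[OF q] \<open>X q < a\<close> by (auto simp: t_def)
    have "0 < g q t"
      using less_iff[of q "X q" t] t X[OF q] q by (auto simp: V_def)
    then have "\<forall>\<^sub>F p in at q within V. 0 < g p t"
      using order_tendstoD(1)[OF tendsto_within_subset[OF tends]] q t by (auto simp: V_def)
    moreover have "\<forall>\<^sub>F p in at q within V. p \<in> V"
      by (auto simp: eventually_at_filter)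
    ultimately show "\<forall>\<^sub>F p in at q within V. X p < a"
    proof eventually_elim
      case (elim p)
      then show ?case
        using less_iff[of p "X p" t] X[of p] t by (auto simp: V_def)
    qed
  qed
  ultimately show thesis
    using that \<open>\<epsilon> > 0\<close> X by (simp add: V_def)
qed

section \<open>Eigenvalues of rank-one perturbations\<close>

lemma rank_one_mult_vec:
  "(B + \<tau> *\<^sub>R outer_product u w) *v v = B *v v + (of_real \<tau> * scalar_product w v) *s u"
  for B :: "complex ^ 'n ^ 'n"
  by (simp add: vec_eq_iff matrix_vector_mult_def outer_product_def scalar_product_def
      distrib_left sum.distrib sum_distrib_left sum_distrib_right mult_ac
      scaleR_conv_of_real[where 'a = complex])

text \<open>An eigenvector \<open>v\<close> solves \<open>(z - B) v = c u\<close> with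
  \<open>c = \<tau> w v\<close>, so it is \<open>c R(z) u\<close>, and \<open>c\<close> is nonzero
  since \<open>v\<close> is. Pairing with \<open>w\<close> and cancelling \<open>c\<close> gives the
  equation. Conversely, \<open>R(z) u\<close> is an eigenvector.\<close>

lemma is_eigenvalue_rank_one_iff:
  assumes "\<not> is_eigenvalue B z"
  shows "is_eigenvalue (B + \<tau> *\<^sub>R outer_product u w) z \<longleftrightarrow> of_real \<tau> * resolvent_fun B u w z = 1"
proof
  assume "is_eigenvalue (B + \<tau> *\<^sub>R outer_product u w) z"
  then obtain v where "v \<noteq> 0" and v: "B *v v + (of_real \<tau> * scalar_product w v) *s u = z *s v"
    by (auto simp: is_eigenvalue_def rank_one_mult_vec)
  define c where "c = of_real \<tau> * scalar_product w v"
  have "z *s v - B *v v = c *s u"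
    using v by (simp add: c_def algebra_simps)
  then have v_eq: "v = c *s resolvent B z u"
    using resolvent_eq_iff[OF assms] by (metis resolvent_scale)
  then have "c \<noteq> 0"
    using \<open>v \<noteq> 0\<close> by auto
  moreover have "c = of_real \<tau> * (c * resolvent_fun B u w z)"
    using v_eq by (metis c_def scalar_product_algebra(3) resolvent_fun_eq)
  ultimately show "of_real \<tau> * resolvent_fun B u w z = 1"
    by simp
next
  assume Q: "of_real \<tau> * resolvent_fun B u w z = 1"
  define v where "v = resolvent B z u"
  have "z *s v - B *v v = u"
    using resolvent_eq_iff[OF assms] v_def by blast
  then have "B *v v + u = z *s v"
    by (metis add.commute diff_add_cancel)
  then have "(B + \<tau> *\<^sub>R outer_product u w) *v v = z *s v"
    using Q by (auto simp: rank_one_mult_vec resolvent_fun_eq v_def)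
  moreover have "v \<noteq> 0"
    using Q by (auto simp: resolvent_fun_eq v_def scalar_product_def)
  ultimately show "is_eigenvalue (B + \<tau> *\<^sub>R outer_product u w) z"
    unfolding is_eigenvalue_def by blast
qed

text \<open>An analytic branch \<open>f\<close> through the critical point would satisfy \<open>Q (f \<tau>) = 1 / \<tau>\<close>;
  differentiating at \<open>\<tau>\<^sub>0\<close> gives \<open>0 = - 1 / \<tau>\<^sub>0\<^sup>2\<close>.\<close>

lemma not_analytic_eigenvalues_near_rank_one:
  assumes ev: "\<not> is_eigenvalue B z" and "\<tau>\<^sub>0 \<noteq> 0"
    and Q: "resolvent_fun B u w z = 1 / of_real \<tau>\<^sub>0" and Q': "resolvent_fun' B u w z = 0"
  shows "\<not> analytic_eigenvalues_near (\<lambda>\<tau>. B + \<tau> *\<^sub>R outer_product u w) \<tau>\<^sub>0 z"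
proof
  let ?M = "\<lambda>\<tau>::real. B + \<tau> *\<^sub>R outer_product u w"
  assume "analytic_eigenvalues_near ?M \<tau>\<^sub>0 z"
  then obtain F r where "r > 0" and F: "\<forall>f\<in>F. f analytic_on {complex_of_real \<tau>\<^sub>0}"
    and eq: "\<forall>\<^sub>F \<tau> in nhds \<tau>\<^sub>0. {y \<in> ball z r. is_eigenvalue (?M \<tau>) y} = (\<lambda>f. f (of_real \<tau>)) ` F"
    unfolding analytic_eigenvalues_near_def by blast
  have "is_eigenvalue (?M \<tau>\<^sub>0) z"
    using is_eigenvalue_rank_one_iff[OF ev] Q \<open>\<tau>\<^sub>0 \<noteq> 0\<close> by simp
  then have "z \<in> (\<lambda>f. f (of_real \<tau>\<^sub>0)) ` F"
    using eventually_nhds_x_imp_x[OF eq] \<open>r > 0\<close> by auto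
  \<comment> \<open>Since \<open>z\<close> is an eigenvalue at \<open>\<tau>\<^sub>0\<close>, some
    branch must pass through it.\<close>
  then obtain f where "f \<in> F" and f: "f (of_real \<tau>\<^sub>0) = z"
    by auto
  obtain f' where f': "(f has_field_derivative f') (at (complex_of_real \<tau>\<^sub>0))"
    using F \<open>f \<in> F\<close> analytic_on_imp_differentiable_at field_differentiable_def by blast
  have branch: "((\<lambda>\<tau>. f (of_real \<tau>)) has_vector_derivative f') (at \<tau>\<^sub>0)"
    using f' by (rule has_vector_derivative_real_field)
  \<comment> \<open>By continuity the branch avoids the spectrum of \<open>B\<close> near
    \<open>\<tau>\<^sub>0\<close>, so the rank-one criterion applies along it.\<close>
  then have "((\<lambda>\<tau>. f (of_real \<tau>)) \<longlongrightarrow> z) (nhds \<tau>\<^sub>0)"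
    using has_vector_derivative_continuous f by (metis isCont_def tendsto_at_iff_tendsto_nhds)
  then have "\<forall>\<^sub>F \<tau> in nhds \<tau>\<^sub>0. \<not> is_eigenvalue B (f (of_real \<tau>))"
    by (intro eventually_not_is_eigenvalue[OF _ _ ev] tendsto_intros)
  with eq have "\<forall>\<^sub>F \<tau> in nhds \<tau>\<^sub>0. of_real \<tau> * resolvent_fun B u w (f (of_real \<tau>)) = 1"
  proof eventually_elim
    case (elim \<tau>)
    have "is_eigenvalue (?M \<tau>) (f (of_real \<tau>))"
      using elim(1) \<open>f \<in> F\<close> by blast
    then show ?case
      using is_eigenvalue_rank_one_iff[OF elim(2)] by blast
  qed
  \<comment> \<open>The equation is differentiated in the form \<open>t * Q (f t) = 1\<close>. As
    \<open>Q' = 0\<close> at \<open>z\<close>, the left side has derivative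
    \<open>Q z = 1 / \<tau>\<^sub>0\<close>, whatever \<open>f'\<close> is.\<close>
  moreover have "((\<lambda>t. t * resolvent_fun B u w (f t)) has_field_derivative
      resolvent_fun B u w z + of_real \<tau>\<^sub>0 * (resolvent_fun' B u w z * f')) (at (of_real \<tau>\<^sub>0))"
    using DERIV_chain2[OF _ f', of "resolvent_fun B u w" "resolvent_fun' B u w z"]
      has_field_derivative_resolvent_fun[OF ev] f
    by (auto intro!: derivative_eq_intros)
  then have "((\<lambda>\<tau>. of_real \<tau> * resolvent_fun B u w (f (of_real \<tau>))) has_vector_derivative 1 / of_real \<tau>\<^sub>0) (at \<tau>\<^sub>0)"
    using has_vector_derivative_real_field Q Q' by fastforce
  ultimately have "((\<lambda>\<tau>. 1) has_vector_derivative 1 / complex_of_real \<tau>\<^sub>0) (at \<tau>\<^sub>0)"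
    by (subst (asm) has_vector_derivative_cong_ev[where g = "\<lambda>_. 1"])
      (auto elim: eventually_mono dest: eventually_nhds_x_imp_x)
  then have "1 / complex_of_real \<tau>\<^sub>0 = 0"
    using vector_derivative_unique_at has_vector_derivative_const by blast
  with \<open>\<tau>\<^sub>0 \<noteq> 0\<close> show False
    by simp
qed

section \<open>Persistence of a double crossing for parametrised data\<close>

text \<open>This treats both cases at once: \<open>p\<close> stands for the pair of matrix and
  vector, and the structure enters only through the assumption that \<open>Q\<close> is real on the
  real axis.\<close>

lemma double_crossing_persists:
  fixes S :: "'p::metric_space set" and B :: "'p \<Rightarrow> complex ^ 'n ^ 'n" and u w :: "'p \<Rightarrow> complex ^ 'n"
  defines "Q \<equiv> \<lambda>p. resolvent_fun (B p) (u p) (w p)"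
  assumes "continuous_on S B" "continuous_on S u" "continuous_on S w" and "p0 \<in> S"
    and real: "\<And>p t. p \<in> S \<Longrightarrow> \<not> is_eigenvalue (B p) (complex_of_real t) \<Longrightarrow> Im (Q p (of_real t)) = 0"
    and "\<tau>\<^sub>0 > 0" and ev: "\<not> is_eigenvalue (B p0) (complex_of_real x)"
    and dc: "double_crossing (Q p0) x \<tau>\<^sub>0"
  obtains \<epsilon> X T where "\<epsilon> > 0"
    "continuous_on (S \<inter> ball p0 \<epsilon>) X" "continuous_on (S \<inter> ball p0 \<epsilon>) T"
    "X p0 = x" "T p0 = \<tau>\<^sub>0"
    "\<And>p. p \<in> S \<inter> ball p0 \<epsilon> \<Longrightarrow> T p > 0 \<and> \<not> is_eigenvalue (B p) (of_real (X p)) \<and>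
       double_crossing (Q p) (X p) (T p) \<and>
       \<not> analytic_eigenvalues_near (\<lambda>\<tau>. B p + \<tau> *\<^sub>R outer_product (u p) (w p)) (T p) (of_real (X p))"
proof -
  define Q' where "Q' = (\<lambda>p. resolvent_fun' (B p) (u p) (w p))"
  define Q'' where "Q'' = (\<lambda>p. resolvent_fun'' (B p) (u p) (w p))"
  note Q_defs = Q_def Q'_def Q''_def
  have eventually_regular: "\<forall>\<^sub>F s in nhds t. \<not> is_eigenvalue (B p) (complex_of_real s)"
    if "\<not> is_eigenvalue (B p) (complex_of_real t)" for p t
    by (intro eventually_not_is_eigenvalue[OF _ _ that] tendsto_intros filterlim_ident)
  have real': "Im (Q' p (of_real t)) = 0"
    if "p \<in> S" "\<not> is_eigenvalue (B p) (complex_of_real t)" for p t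
    using that unfolding Q'_def
    by (intro Im_has_field_derivative_eq_0[OF has_field_derivative_resolvent_fun]
        eventually_mono[OF eventually_regular] real[unfolded Q_def])
  have real'': "Im (Q'' p (of_real t)) = 0"
    if "p \<in> S" "\<not> is_eigenvalue (B p) (complex_of_real t)" for p t
    using that unfolding Q''_def
    by (intro Im_has_field_derivative_eq_0[OF has_field_derivative_resolvent_fun']
        eventually_mono[OF eventually_regular] real'[unfolded Q'_def])
  have base: "Q p0 (of_real x) = 1 / of_real \<tau>\<^sub>0" "Q' p0 (of_real x) = 0" "Q'' p0 (of_real x) \<noteq> 0"
    using dc ev by (auto simp: double_crossing_def Q_defs deriv_resolvent_fun deriv_deriv_resolvent_fun)
  \<comment> \<open>Multiplying by the sign of \<open>Q''\<close> reduces the decreasing case to the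
    increasing one.\<close>
  define \<sigma> where "\<sigma> = sgn (Re (Q'' p0 (of_real x)))"
  have "Re (Q'' p0 (of_real x)) \<noteq> 0"
    using base real''[OF \<open>p0 \<in> S\<close> ev] by (auto simp: complex_eq_iff)
  then have \<sigma>: "\<sigma> * Re (Q'' p0 (of_real x)) > 0" "\<sigma> \<noteq> 0"
    by (auto simp: \<sigma>_def sgn_real_def)
  have limits: "(B \<longlongrightarrow> B p) (at p within S)" "(u \<longlongrightarrow> u p) (at p within S)" "(w \<longlongrightarrow> w p) (at p within S)"
    if "p \<in> S" for p
    using assms that by (auto simp: continuous_on_def)

  \<comment> \<open>\<open>G\<close> collects the open conditions at \<open>(p, t)\<close>: the
    resolvent exists, \<open>Q\<close> is positive so that \<open>1 / Q\<close> is a valid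
    parameter, and \<open>Q''\<close> keeps its sign so that \<open>Q'\<close> is monotone.\<close>
  define G where "G = (\<lambda>p t. \<not> is_eigenvalue (B p) (complex_of_real t) \<and>
      Re (Q p (of_real t)) > 0 \<and> \<sigma> * Re (Q'' p (of_real t)) > 0)"
  have "G p0 x"
    using ev base \<sigma> \<open>\<tau>\<^sub>0 > 0\<close> by (simp add: G_def Re_divide_of_real)
  define W where "W = at (p0, x) within S \<times> UNIV"
  have "((\<lambda>y. B (fst y)) \<longlongrightarrow> B p0) W" "((\<lambda>y. u (fst y)) \<longlongrightarrow> u p0) W" "((\<lambda>y. w (fst y)) \<longlongrightarrow> w p0) W"
    using continuous_on_compose2[OF _ continuous_on_fst[OF continuous_on_id], of S _ "S \<times> (UNIV :: real set)"]
      assms(2-5) by (auto simp: W_def continuous_on_def dest!: bspec[of _ _ "(p0, x)"])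
  note W_limits = this
  have "((\<lambda>y. complex_of_real (snd y)) \<longlongrightarrow> of_real x) W"
    unfolding W_def by (auto intro!: tendsto_eq_intros)
  note W_limits = W_limits this
  have "\<forall>\<^sub>F y in W. \<not> is_eigenvalue (B (fst y)) (complex_of_real (snd y))"
    by (intro eventually_not_is_eigenvalue[OF _ _ ev] W_limits)
  moreover have "\<forall>\<^sub>F y in W. 0 < Re (Q (fst y) (of_real (snd y)))"
    using \<open>G p0 x\<close> unfolding Q_defs G_def
    by (intro order_tendstoD(1)[OF tendsto_Re[OF tendsto_resolvent_funs(1)[OF W_limits ev]]]) auto
  moreover have "\<forall>\<^sub>F y in W. 0 < \<sigma> * Re (Q'' (fst y) (of_real (snd y)))"
    using \<open>G p0 x\<close> unfolding Q_defs G_def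
    by (intro order_tendstoD(1)[OF tendsto_mult[OF tendsto_const tendsto_Re[OF tendsto_resolvent_funs(3)[OF W_limits ev]]]]) auto
  ultimately have "\<forall>\<^sub>F y in W. G (fst y) (snd y)"
    by eventually_elim (simp add: G_def)
  \<comment> \<open>The filter \<open>W\<close> omits the point \<open>(p0, x)\<close> itself;
    \<open>G p0 x\<close> puts it back.\<close>
  then obtain d where "d > 0"
    and d: "\<And>p t. p \<in> S \<Longrightarrow> dist (p, t) (p0, x) < d \<Longrightarrow> G p t"
    using \<open>G p0 x\<close> unfolding W_def eventually_at by fastforce
  \<comment> \<open>Half of \<open>d\<close> for each coordinate keeps the pair within distance
    \<open>d\<close>. The ball is open, so the inequality stays strict at the endpoints of the
    closed interval.\<close>
  define \<eta> S' where "\<eta> = d / 2" and "S' = S \<inter> ball p0 \<eta>"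
  have G: "G p t" if "p \<in> S'" "t \<in> {x-\<eta>..x+\<eta>}" for p t
  proof (rule d)
    have "dist (p, t) (p0, x) \<le> dist p p0 + dist t x"
      by (simp add: dist_Pair_Pair sqrt_sum_squares_le_sum)
    also have "\<dots> < d"
      using that by (auto simp: S'_def \<eta>_def dist_real_def dist_commute)
    finally show "dist (p, t) (p0, x) < d" .
  qed (use that S'_def in auto)

  \<comment> \<open>This is the sign-normalised real function \<open>Q'\<close>, whose derivative in
    \<open>t\<close> is positive wherever \<open>G\<close> holds.\<close>
  define g where "g = (\<lambda>p t. \<sigma> * Re (Q' p (of_real t)))"
  have g_deriv: "(g p has_real_derivative \<sigma> * Re (Q'' p (of_real t))) (at t)" if "G p t" for p t
  proof -
    have "((\<lambda>t. Q' p (of_real t)) has_vector_derivative Q'' p (of_real t)) (at t)"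
      using that has_vector_derivative_real_field[OF has_field_derivative_resolvent_fun']
      by (auto simp: G_def Q_defs)
    then have "((\<lambda>t. Re (Q' p (of_real t))) has_real_derivative Re (Q'' p (of_real t))) (at t)"
      using bounded_linear.has_vector_derivative[OF bounded_linear_Re]
      by (simp add: has_real_derivative_iff_has_vector_derivative)
    then show ?thesis
      unfolding g_def by (rule DERIV_cmult)
  qed
  have "p0 \<in> S'" "\<eta> > 0"
    using \<open>p0 \<in> S\<close> \<open>d > 0\<close> by (auto simp: S'_def \<eta>_def)
  moreover have "continuous_on S' (\<lambda>p. g p t)" if "t \<in> {x-\<eta>..x+\<eta>}" for t
    unfolding continuous_on_def
  proof
    fix p assume "p \<in> S'"
    then have "p \<in> S" "\<not> is_eigenvalue (B p) (complex_of_real t)"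
      using G[OF _ that] by (auto simp: G_def S'_def)
    then have "((\<lambda>p. g p t) \<longlongrightarrow> g p t) (at p within S)"
      unfolding g_def Q'_def by (intro tendsto_intros tendsto_resolvent_funs limits)
    then show "((\<lambda>p. g p t) \<longlongrightarrow> g p t) (at p within S')"
      by (rule tendsto_within_subset) (auto simp: S'_def)
  qed
  moreover have "continuous_on {x-\<eta>..x+\<eta>} (g p)" if "p \<in> S'" for p
    using g_deriv[OF G[OF that]] by (meson DERIV_continuous_on has_field_derivative_at_within)
  moreover have "strict_mono_on {x-\<eta>..x+\<eta>} (g p)" if "p \<in> S'" for p
  proof (rule strict_mono_onI)
    fix r s assume rs: "r \<in> {x-\<eta>..x+\<eta>}" "s \<in> {x-\<eta>..x+\<eta>}" "r < s"
    show "g p r < g p s"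
    proof (rule DERIV_pos_imp_increasing[OF \<open>r < s\<close>])
      fix t assume "r \<le> t" "t \<le> s"
      then have "G p t"
        using rs by (intro G[OF that]) auto
      then show "\<exists>y. (g p has_real_derivative y) (at t) \<and> 0 < y"
        using g_deriv by (auto simp: G_def)
    qed
  qed
  moreover have "g p0 x = 0"
    using base by (simp add: g_def)
  ultimately obtain \<epsilon> X where "\<epsilon> > 0" and contX: "continuous_on (S' \<inter> ball p0 \<epsilon>) X" and "X p0 = x"
    and X: "\<And>p. p \<in> S' \<inter> ball p0 \<epsilon> \<Longrightarrow> X p \<in> {x-\<eta><..<x+\<eta>} \<and> g p (X p) = 0"
    using monotone_implicit_function[of p0 S' \<eta> x g] by blast
  define \<epsilon>' V where "\<epsilon>' = min \<eta> \<epsilon>" and "V = S \<inter> ball p0 \<epsilon>'"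
  have V: "V = S' \<inter> ball p0 \<epsilon>"
    by (auto simp: V_def S'_def \<epsilon>'_def)
  have GX: "G p (X p)" if "p \<in> V" for p
    using X[of p] G[of p "X p"] that by (auto simp: V)
  have regX: "\<not> is_eigenvalue (B p) (of_real (X p))" if "p \<in> V" for p
    using GX[OF that] by (simp add: G_def)
  define T where "T = (\<lambda>p. 1 / Re (Q p (of_real (X p))))"
  have "continuous_on V (\<lambda>p. Re (Q p (of_real (X p))))"
    unfolding continuous_on_def Q_def
  proof
    fix p assume "p \<in> V"
    have sub: "V \<subseteq> S"
      by (auto simp: V_def)
    have "(X \<longlongrightarrow> X p) (at p within V)"
      using contX \<open>p \<in> V\<close> V by (auto simp: continuous_on_def)
    with \<open>p \<in> V\<close> sub show "((\<lambda>p. Re (resolvent_fun (B p) (u p) (w p) (of_real (X p)))) \<longlongrightarrow>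
        Re (resolvent_fun (B p) (u p) (w p) (of_real (X p)))) (at p within V)"
      by (intro tendsto_intros tendsto_resolvent_funs regX limits[THEN tendsto_within_subset]) auto
  qed
  moreover have "\<forall>p\<in>V. Re (Q p (of_real (X p))) \<noteq> 0"
    using GX unfolding G_def by fastforce
  ultimately have "continuous_on V T"
    unfolding T_def by (intro continuous_on_divide continuous_on_const)
  moreover have "T p > 0 \<and> \<not> is_eigenvalue (B p) (of_real (X p)) \<and> double_crossing (Q p) (X p) (T p) \<and>
       \<not> analytic_eigenvalues_near (\<lambda>\<tau>. B p + \<tau> *\<^sub>R outer_product (u p) (w p)) (T p) (of_real (X p))"
    if "p \<in> V" for p
  proof -
    have "p \<in> S"
      using that by (simp add: V_def)
    have "T p > 0"
      using GX[OF that] by (simp add: T_def G_def)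
    \<comment> \<open>The constructions control real parts only; realness of \<open>Q\<close>, and
      of \<open>Q'\<close> in the next step, upgrades them to complex equations.\<close>
    moreover have "Q p (of_real (X p)) = 1 / of_real (T p)"
      using real[OF \<open>p \<in> S\<close> regX[OF that]] by (simp add: T_def complex_eq_iff)
    moreover have "Q' p (of_real (X p)) = 0"
      using real'[OF \<open>p \<in> S\<close> regX[OF that]] X[of p] that \<sigma> by (auto simp: V g_def complex_eq_iff)
    moreover have "Q'' p (of_real (X p)) \<noteq> 0"
      using GX[OF that] by (auto simp: G_def)
    ultimately show ?thesis
      using regX[OF that] not_analytic_eigenvalues_near_rank_one[OF regX[OF that], of "T p"]
      by (auto simp: double_crossing_def Q_defs deriv_resolvent_fun deriv_deriv_resolvent_fun)
  qed
  moreover have "T p0 = \<tau>\<^sub>0"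
    using base \<open>X p0 = x\<close> by (simp add: T_def Re_divide_of_real)
  ultimately show thesis
    using that[of \<epsilon>' X T] contX \<open>X p0 = x\<close> \<open>\<epsilon> > 0\<close> \<open>\<eta> > 0\<close> V
    unfolding V_def by (auto simp: \<epsilon>'_def)
qed

section \<open>Realness of \<open>Q\<close> on the real axis\<close>

lemma scalar_product_vector_matrix_mult:
  fixes v :: "'a::comm_semiring_1 ^ 'm" and M :: "'a ^ 'n ^ 'm"
  shows "scalar_product (v v* M) y = scalar_product v (M *v y)"
  unfolding scalar_product_def vector_matrix_mult_def matrix_vector_mult_def
  by (simp add: sum_distrib_left sum_distrib_right mult_ac) (rule sum.swap)

definition herm :: "complex ^ 'n \<Rightarrow> complex ^ 'n \<Rightarrow> complex" where
  "herm a b = scalar_product (map_vector cnj a) b"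

lemma cnj_herm: "cnj (herm a b) = herm b a"
  by (simp add: herm_def scalar_product_def map_vector_def mult.commute)

lemma herm_diff_left: "herm (a - b) c = herm a c - herm b c"
  and herm_diff_right: "herm a (b - c) = herm a b - herm a c"
  and herm_scale_left: "herm (k *s a) b = cnj k * herm a b"
  and herm_scale_right: "herm a (k *s b) = k * herm a b"
  by (simp_all add: herm_def scalar_product_def map_vector_def left_diff_distrib right_diff_distrib
      sum_subtractf sum_distrib_left mult_ac)

lemma herm_matrix_left: "herm (M *v a) b = herm a (conj_transpose M *v b)"
proof -
  have "map_vector cnj (M *v a) = map_vector cnj a v* conj_transpose M"
    by (simp add: vec_eq_iff map_vector_def matrix_vector_mult_def vector_matrix_mult_def
        conj_transpose_def transpose_def mult.commute)
  then show ?thesis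
    by (simp add: herm_def scalar_product_vector_matrix_mult)
qed

text \<open>Let \<open>y = R(t) u\<close>, so that \<open>u = (t - B) y\<close> and
  \<open>Q = u* H y\<close>. As \<open>H\<close> is Hermitian, the conjugate of \<open>Q\<close> is
  \<open>y* H u = t y* H y - y* H B y\<close>. Replacing \<open>H B\<close> by \<open>B* H\<close>
  and using that \<open>t\<close> is real turns this into \<open>((t - B) y)* H y\<close>, which is
  \<open>Q\<close> again.\<close>

lemma Im_Q_H_eq_0:
  assumes H: "conj_transpose H = H" "H_selfadjoint H B"
    and ev: "\<not> is_eigenvalue B (complex_of_real t)"
  shows "Im (Q_H H B u (of_real t)) = 0"
proof -
  define y where "y = resolvent B (of_real t) u"
  have u: "u = of_real t *s y - B *v y"
    using resolvent_eq_iff[OF ev] y_def by metis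
  have Q: "Q_H H B u (of_real t) = herm u (H *v y)"
    by (simp add: Q_H_def resolvent_fun_eq row_H_def scalar_product_vector_matrix_mult herm_def y_def)
  have HB: "H *v (B *v y) = conj_transpose B *v (H *v y)"
    using H(2) by (simp add: H_selfadjoint_def matrix_vector_mul_assoc)
  have "cnj (herm u (H *v y)) = herm y (H *v u)"
    by (simp add: cnj_herm herm_matrix_left H(1))
  also have "\<dots> = of_real t * herm y (H *v y) - herm y (conj_transpose B *v (H *v y))"
    by (simp add: u matrix_vector_mult_diff_distrib vector_scalar_commute HB
        herm_diff_right herm_scale_right)
  also have "\<dots> = herm u (H *v y)"
    by (simp add: u herm_diff_left herm_scale_left herm_matrix_left)
  finally show ?thesis
    by (simp add: Q complex_eq_iff)
qed

text \<open>The vector \<open>R(t) u\<close> solves a linear system with real coefficients, so its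
  conjugate solves the same system. By uniqueness it is real, and so is its product with a real row
  vector.\<close>

lemma Im_Q_J_eq_0:
  assumes ev: "\<not> is_eigenvalue (map_matrix complex_of_real B) (complex_of_real t)"
  shows "Im (Q_J J B u (of_real t)) = 0"
proof -
  let ?B = "map_matrix complex_of_real B" and ?u = "map_vector complex_of_real u"
  define y where "y = resolvent ?B (of_real t) ?u"
  have "of_real t *s y - ?B *v y = ?u"
    using resolvent_eq_iff[OF ev] y_def by blast
  then have "cnj ((of_real t *s y - ?B *v y) $ i) = cnj (?u $ i)" for i
    by simp
  then have "of_real t *s map_vector cnj y - ?B *v map_vector cnj y = ?u"
    by (simp add: vec_eq_iff map_vector_def matrix_vector_mult_def)
  then have "map_vector cnj y = y"
    using resolvent_eq_iff[OF ev] y_def by metis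
  then have "cnj (y $ i) = y $ i" for i
    by (metis map_vector_def vec_lambda_beta)
  then have "cnj (Q_J J B u (of_real t)) = Q_J J B u (of_real t)"
    unfolding Q_J_def resolvent_fun_eq y_def[symmetric]
    by (simp add: scalar_product_def map_vector_def)
  then show ?thesis
    by (simp add: complex_eq_iff)
qed

section \<open>The selfadjoint and the Hamiltonian case\<close>

lemma pert_J_eq:
  "pert_J J B u = (\<lambda>\<tau>. map_matrix complex_of_real B + \<tau> *\<^sub>R outer_product
     (map_vector complex_of_real u) (map_vector complex_of_real (row_J J u)))"
  by (simp add: fun_eq_iff vec_eq_iff pert_J_def outer_product_def map_vector_def
      scaleR_conv_of_real[where 'a = complex])

text \<open>Passes from separate bounds on matrix and vector, as in \<open>nbhd_H\<close> and
  \<open>nbhd_J\<close>, to the product metric of the abstract persistence result.\<close>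

lemma prod_nbhd_subset_ball:
  assumes "norm (B - A) < \<epsilon> / 2" "norm (w - u) < \<epsilon> / 2"
  shows "(B, w) \<in> ball (A, u) \<epsilon>"
proof -
  have "dist (A, u) (B, w) \<le> norm (B - A) + norm (w - u)"
    by (simp add: dist_norm norm_minus_commute norm_Pair_le)
  also have "\<dots> < \<epsilon>"
    using assms by simp
  finally show ?thesis
    by simp
qed

lemma persistence_H:
  fixes A H :: "complex ^ 'n ^ 'n"
  assumes H: "conj_transpose H = H" "H_selfadjoint H A" and "\<tau>\<^sub>0 > 0"
    and "\<not> is_eigenvalue A (complex_of_real x)" "double_crossing (Q_H H A u) x \<tau>\<^sub>0"
  shows "\<exists>\<delta>>0. \<exists>X T.
     continuous_on (nbhd_H H A u \<delta>) X \<and> continuous_on (nbhd_H H A u \<delta>) T \<and>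
     X (A, u) = x \<and> T (A, u) = \<tau>\<^sub>0 \<and>
     (\<forall>(B, w) \<in> nbhd_H H A u \<delta>.
        T (B, w) > 0 \<and>
        \<not> is_eigenvalue B (of_real (X (B, w))) \<and>
        double_crossing (Q_H H B w) (X (B, w)) (T (B, w)) \<and>
        \<not> analytic_eigenvalues_near (pert_H H B w) (T (B, w)) (of_real (X (B, w))))"
proof -
  \<comment> \<open>The parameter set carries the selfadjointness constraint, because
    \<open>Im_Q_H_eq_0\<close> is available for such matrices.\<close>
  define S where "S = {p :: (complex ^ 'n ^ 'n) \<times> (complex ^ 'n). H_selfadjoint H (fst p)}"
  have cont: "continuous_on S (\<lambda>p. row_H H (snd p))"
    unfolding row_H_def map_vector_def vector_matrix_mult_def by (auto intro!: continuous_intros)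
  obtain \<epsilon> X T where "\<epsilon> > 0"
    and XT: "continuous_on (S \<inter> ball (A, u) \<epsilon>) X" "continuous_on (S \<inter> ball (A, u) \<epsilon>) T"
      "X (A, u) = x" "T (A, u) = \<tau>\<^sub>0"
    and *: "\<And>p. p \<in> S \<inter> ball (A, u) \<epsilon> \<Longrightarrow> T p > 0 \<and> \<not> is_eigenvalue (fst p) (of_real (X p)) \<and>
       double_crossing (resolvent_fun (fst p) (snd p) (row_H H (snd p))) (X p) (T p) \<and>
       \<not> analytic_eigenvalues_near (\<lambda>\<tau>. fst p + \<tau> *\<^sub>R outer_product (snd p) (row_H H (snd p)))
         (T p) (of_real (X p))"
    by (rule double_crossing_persists[of S fst snd "\<lambda>p. row_H H (snd p)" "(A, u)" \<tau>\<^sub>0 x])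
      (use assms cont Im_Q_H_eq_0[OF H(1)] in \<open>auto simp: S_def Q_H_def intro!: continuous_intros\<close>)
  have sub: "nbhd_H H A u (\<epsilon> / 2) \<subseteq> S \<inter> ball (A, u) \<epsilon>"
    by (auto simp: nbhd_H_def S_def prod_nbhd_subset_ball simp del: mem_ball)
  have pert: "pert_H H B w = (\<lambda>\<tau>. B + \<tau> *\<^sub>R outer_product w (row_H H w))" for B w
    by (simp add: fun_eq_iff pert_H_def)
  have "T (B, w) > 0 \<and> \<not> is_eigenvalue B (of_real (X (B, w))) \<and>
      double_crossing (Q_H H B w) (X (B, w)) (T (B, w)) \<and>
      \<not> analytic_eigenvalues_near (pert_H H B w) (T (B, w)) (of_real (X (B, w)))"
    if "(B, w) \<in> nbhd_H H A u (\<epsilon> / 2)" for B w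
    using *[OF subsetD[OF sub that]] by (simp add: Q_H_def pert)
  then show ?thesis
    using \<open>\<epsilon> > 0\<close> XT(3,4) XT(1,2)[THEN continuous_on_subset, OF sub]
    by (intro exI[of _ "\<epsilon> / 2"] conjI exI[of _ X] exI[of _ T]) auto
qed

lemma persistence_J:
  fixes A J :: "real ^ 'n ^ 'n"
  assumes "\<tau>\<^sub>0 > 0"
    and "\<not> is_eigenvalue (map_matrix complex_of_real A) (complex_of_real x)" "double_crossing (Q_J J A u) x \<tau>\<^sub>0"
  shows "\<exists>\<delta>>0. \<exists>X T.
     continuous_on (nbhd_J J A u \<delta>) X \<and> continuous_on (nbhd_J J A u \<delta>) T \<and>
     X (A, u) = x \<and> T (A, u) = \<tau>\<^sub>0 \<and>
     (\<forall>(B, w) \<in> nbhd_J J A u \<delta>.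
        T (B, w) > 0 \<and>
        \<not> is_eigenvalue (map_matrix complex_of_real B) (of_real (X (B, w))) \<and>
        double_crossing (Q_J J B w) (X (B, w)) (T (B, w)) \<and>
        \<not> analytic_eigenvalues_near (pert_J J B w) (T (B, w)) (of_real (X (B, w))))"
proof -
  \<comment> \<open>The parameters are all real pairs; \<open>X\<close> and \<open>T\<close> are
    restricted to \<open>nbhd_J\<close> afterwards.\<close>
  define S where "S = (UNIV :: ((real ^ 'n ^ 'n) \<times> (real ^ 'n)) set)"
  let ?B = "\<lambda>p. map_matrix complex_of_real (fst p :: real ^ 'n ^ 'n)"
  let ?u = "\<lambda>p. map_vector complex_of_real (snd p)"
  let ?w = "\<lambda>p. map_vector complex_of_real (row_J J (snd p))"
  have cont: "continuous_on S ?B" "continuous_on S ?u" "continuous_on S ?w"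
    unfolding row_J_def map_vector_def vector_matrix_mult_def map_matrix_def
    by (auto intro!: continuous_intros)
  obtain \<epsilon> X T where "\<epsilon> > 0"
    and XT: "continuous_on (S \<inter> ball (A, u) \<epsilon>) X" "continuous_on (S \<inter> ball (A, u) \<epsilon>) T"
      "X (A, u) = x" "T (A, u) = \<tau>\<^sub>0"
    and *: "\<And>p. p \<in> S \<inter> ball (A, u) \<epsilon> \<Longrightarrow> T p > 0 \<and> \<not> is_eigenvalue (?B p) (of_real (X p)) \<and>
       double_crossing (resolvent_fun (?B p) (?u p) (?w p)) (X p) (T p) \<and>
       \<not> analytic_eigenvalues_near (\<lambda>\<tau>. ?B p + \<tau> *\<^sub>R outer_product (?u p) (?w p))
         (T p) (of_real (X p))"
    by (rule double_crossing_persists[of S ?B ?u ?w "(A, u)" \<tau>\<^sub>0 x])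
      (use assms cont Im_Q_J_eq_0 in \<open>auto simp: S_def Q_J_def\<close>)
  have sub: "nbhd_J J A u (\<epsilon> / 2) \<subseteq> S \<inter> ball (A, u) \<epsilon>"
    by (auto simp: nbhd_J_def S_def prod_nbhd_subset_ball simp del: mem_ball)
  have "T (B, w) > 0 \<and> \<not> is_eigenvalue (map_matrix complex_of_real B) (of_real (X (B, w))) \<and>
      double_crossing (Q_J J B w) (X (B, w)) (T (B, w)) \<and>
      \<not> analytic_eigenvalues_near (pert_J J B w) (T (B, w)) (of_real (X (B, w)))"
    if "(B, w) \<in> nbhd_J J A u (\<epsilon> / 2)" for B w
    using *[OF subsetD[OF sub that]] by (simp add: Q_J_def pert_J_eq)
  then show ?thesis
    using \<open>\<epsilon> > 0\<close> XT(3,4) XT(1,2)[THEN continuous_on_subset, OF sub]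
    by (intro exI[of _ "\<epsilon> / 2"] conjI exI[of _ X] exI[of _ T]) auto
qed

theorem theorem24:
  shows
  "(\<forall>(H :: complex ^ 'n ^ 'n) A u (\<tau>\<^sub>0 :: real) (x :: real).
      invertible H \<and> conj_transpose H = H \<and> H_selfadjoint H A \<and> u \<noteq> 0 \<and>
      \<tau>\<^sub>0 > 0 \<and> \<not> is_eigenvalue A (of_real x) \<and> double_crossing (Q_H H A u) x \<tau>\<^sub>0
      \<longrightarrow>
      (\<exists>\<delta>>0. \<exists>X T.
         continuous_on (nbhd_H H A u \<delta>) X \<and> continuous_on (nbhd_H H A u \<delta>) T \<and>
         X (A, u) = x \<and> T (A, u) = \<tau>\<^sub>0 \<and>
         (\<forall>(B, w) \<in> nbhd_H H A u \<delta>.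
            T (B, w) > 0 \<and>
            \<not> is_eigenvalue B (of_real (X (B, w))) \<and>
            double_crossing (Q_H H B w) (X (B, w)) (T (B, w)) \<and>
            \<not> analytic_eigenvalues_near (pert_H H B w) (T (B, w)) (of_real (X (B, w))))))
   \<and>
   (\<forall>(J :: real ^ 'n ^ 'n) A u (\<tau>\<^sub>0 :: real) (x :: real).
      invertible J \<and> transpose J = - J \<and> J_Hamiltonian J A \<and> u \<noteq> 0 \<and>
      \<tau>\<^sub>0 > 0 \<and> \<not> is_eigenvalue (map_matrix complex_of_real A) (of_real x) \<and>
      double_crossing (Q_J J A u) x \<tau>\<^sub>0
      \<longrightarrow>
      (\<exists>\<delta>>0. \<exists>X T.
         continuous_on (nbhd_J J A u \<delta>) X \<and> continuous_on (nbhd_J J A u \<delta>) T \<and>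
         X (A, u) = x \<and> T (A, u) = \<tau>\<^sub>0 \<and>
         (\<forall>(B, w) \<in> nbhd_J J A u \<delta>.
            T (B, w) > 0 \<and>
            \<not> is_eigenvalue (map_matrix complex_of_real B) (of_real (X (B, w))) \<and>
            double_crossing (Q_J J B w) (X (B, w)) (T (B, w)) \<and>
            \<not> analytic_eigenvalues_near (pert_J J B w) (T (B, w)) (of_real (X (B, w))))))"
  by (intro conjI allI impI; elim conjE; rule persistence_H persistence_J; assumption)

end
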